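(* Let $L=2\ell\ge 2$ be even and $A=\{1,L,L+1\}$, which is cash-periodic with period $m=2L$. Let $X\subseteq\mathbf{CS}_A$ be the set of triples $(i,x,y)\in\mathbf{CS}_A$ such that: - if $i$ is odd or $i=L$, then $y\ge\left\lfloor\frac{x}{\ell}\right\rfloor\ell$; - if $i$ is even and $i\ne L$, then $x<\left\lfloor\frac{y}{\ell}\right\rfloor\ell$. Then $X$ is a solution set for $A$.
   Context: $\mathbb{N}=\{0,1,2,\dots\}$; here $a_1=\min(A)=1$. NIM for $A$: there are $n$ stones on the board; Players I and II alternate, Player I first, each removing $a\in A$ stones ($a$ at most the number of stones present); a player who cannot move loses. $W_A(n)\in\{\mathrm{I},\mathrm{II}\}$ is the player with a winning strategy. The functions $f_A^{I},f_A^{II}:\mathbb{N}\to\mathbb{N}$, by simultaneous recursion (below, $a$ ranges over elements of $A$ with $a\le n$): - $f_A^{I}(0)=f_A^{II}(0)=0$. - If $n\ge 1$: $f_A^{II}(n)=\max_a f_A^{I}(n-a)$. - If $n\ge 1$ and $W_A(n)=\mathrm{I}$: $f_A^{I}(n)=\min\{f_A^{II}(n-a)+a : W_A(n-a)=\mathrm{II}\}$. - If $n\ge 1$ and $W_A(n)=\mathrm{II}$: $f_A^{I}(n)=\min\{f_A^{II}(n-a)+a : f_A^{I}(n-a)=f_A^{II}(n)\}$. For $a\in A$, $a\le n$, let $C_A^{I}(n,a)=f_A^{I}(n)-f_A^{II}(n-a)-a$ and $C_A^{II}(n,a)=f_A^{II}(n)-f_A^{I}(n-a)$. $A$ is cash-periodic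 with period $m$ if for all $n_1\equiv n_2\pmod m$: $W_A(n_1)=W_A(n_2)$, and for all $a\in A$ with $a\le n_1,n_2$, $C_A^{I}(n_1,a)=C_A^{I}(n_2,a)$ and $C_A^{II}(n_1,a)=C_A^{II}(n_2,a)$. In that case, for $0\le i<m$ and $a\in A$, $c_A^{I}(i,a)=C_A^{I}(n,a)$ and $c_A^{II}(i,a)=C_A^{II}(n,a)$ for any $n\ge a$ with $n\equiv i\pmod m$ (independent of $n$). $\mathbf{CS}_A$ is the set of integer triples $(i,b,b^\dagger)$ with $0\le i<m$ and $b,b^\dagger\ge0$. A solution set for $A$ is a subset $X\subseteq\mathbf{CS}_A$ such that: - for every $(i,b,b^\dagger)\in X$, putting $(i',b',b^{\dagger\prime})=(i-a_1\bmod m,\ b^\dagger-c_A^{II}(i,a_1),\ b-c_A^{I}(i,a_1))$, one of the following holds: $(i',b',b^{\dagger\prime})\in\mathbf{CS}_A\setminus X$; or $b'\ge0$ and $b^{\dagger\prime}<0$; or $b'<0$, $b^{\dagger\prime}<0$ and $W_A(i')=\mathrm{II}$; - for every $(i,b,b^\dagger)\in\mathbf{CS}_A\setminus X$ and every $a\in A$, putting $(i',b',b^{\dagger\prime})=(i-a\bmod m,\ b^\dagger-c_A^{II}(i,a),\ b-c_A^{I}(i,a))$, one of the following holds: $(i',b',b^{\dagger\prime})\in X$; or $b'<0$ and $b^{\dagger\prime}\ge0$; or $b'<0$, $b^{\dagger\prime}<0$ and $W_A(i')=\mathrm{I}$. *)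

theory Defs
  imports Main "HOL-Number_Theory.Cong"
begin

section \<open>The game NIM for a set of moves\<close>

datatype player = PlayerI | PlayerII

text \<open>The set \<open>A\<close> is meant to consist of positive integers. The guard \<open>0 < a\<close> only serves
  to make the recursions below terminate for arbitrary \<open>A\<close>.\<close>

definition moves :: "nat set \<Rightarrow> nat \<Rightarrow> nat set" where
  "moves A n = {a \<in> A. 0 < a \<and> a \<le> n}"

text \<open>A play from \<open>n\<close> stones, possibly unfinished, is the list of the numbers of stones removed so
  far. Player I makes the moves with even index. Strategies may depend on the whole play so far.\<close>

definition stones_left :: "nat \<Rightarrow> nat list \<Rightarrow> nat" where
  "stones_left n as = n - sum_list as"

definition to_move :: "nat list \<Rightarrow> player" where
  "to_move as = (if even (length as) then PlayerI else PlayerII)"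

definition legal_play :: "nat set \<Rightarrow> nat \<Rightarrow> nat list \<Rightarrow> bool" where
  "legal_play A n as \<longleftrightarrow> (\<forall>k < length as. as ! k \<in> moves A (stones_left n (take k as)))"

definition follows :: "(nat list \<Rightarrow> nat) \<Rightarrow> player \<Rightarrow> nat list \<Rightarrow> bool" where
  "follows \<sigma> p as \<longleftrightarrow> (\<forall>k < length as. to_move (take k as) = p \<longrightarrow> as ! k = \<sigma> (take k as))"

text \<open>The first conjunct says that \<open>\<sigma>\<close> prescribes a legal move whenever \<open>p\<close> has one, the second
  that it is always the opponent who ends up unable to move.\<close>

definition winning_strategy :: "nat set \<Rightarrow> nat \<Rightarrow> player \<Rightarrow> (nat list \<Rightarrow> nat) \<Rightarrow> bool" where
  "winning_strategy A n p \<sigma> \<longleftrightarrow>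
    (\<forall>as. legal_play A n as \<and> follows \<sigma> p as \<longrightarrow>
      (to_move as = p \<and> moves A (stones_left n as) \<noteq> {} \<longrightarrow> \<sigma> as \<in> moves A (stones_left n as)) \<and>
      (moves A (stones_left n as) = {} \<longrightarrow> to_move as \<noteq> p))"

definition W :: "nat set \<Rightarrow> nat \<Rightarrow> player" where
  "W A n = (THE p. \<exists>\<sigma>. winning_strategy A n p \<sigma>)"


section \<open>The cash functions\<close>

text \<open>\<open>Max\<close> and \<open>Min\<close> are taken over nonempty sets when \<open>A\<close> is a finite set of positive integers
  with \<open>1 \<in> A\<close>.\<close>

text \<open>The congruence rule makes \<open>a \<in> moves A n\<close> available in the termination proof for the call
  \<open>fI A (n - a)\<close> inside the set comprehension.\<close>

declare conj_cong [fundef_cong]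

function fI :: "nat set \<Rightarrow> nat \<Rightarrow> nat" and fII :: "nat set \<Rightarrow> nat \<Rightarrow> nat" where
  "fI A n =
    (if n = 0 then 0
     else if W A n = PlayerI
       then Min ((\<lambda>a. fII A (n - a) + a) ` {a \<in> moves A n. W A (n - a) = PlayerII})
       else Min ((\<lambda>a. fII A (n - a) + a) ` {a \<in> moves A n. fI A (n - a) = fII A n}))"
| "fII A n = (if n = 0 then 0 else Max ((\<lambda>a. fI A (n - a)) ` moves A n))"
  by pat_completeness auto
termination
  by (relation "measure (\<lambda>x. case x of Inl (A, n) \<Rightarrow> 2 * n + 1 | Inr (A, n) \<Rightarrow> 2 * n)")
    (auto simp: moves_def)

declare conj_cong [fundef_cong del]
declare fI.simps [simp del] fII.simps [simp del]

definition CI :: "nat set \<Rightarrow> nat \<Rightarrow> nat \<Rightarrow> int" where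
  "CI A n a = int (fI A n) - int (fII A (n - a)) - int a"

definition CII :: "nat set \<Rightarrow> nat \<Rightarrow> nat \<Rightarrow> int" where
  "CII A n a = int (fII A n) - int (fI A (n - a))"

definition cash_periodic :: "nat set \<Rightarrow> nat \<Rightarrow> bool" where
  "cash_periodic A m \<longleftrightarrow> 0 < m \<and>
    (\<forall>n1 n2. [n1 = n2] (mod m) \<longrightarrow>
      W A n1 = W A n2 \<and>
      (\<forall>a\<in>A. a \<le> n1 \<and> a \<le> n2 \<longrightarrow> CI A n1 a = CI A n2 a \<and> CII A n1 a = CII A n2 a))"

text \<open>The common value along a residue class; meaningful if \<open>cash_periodic A m\<close> and \<open>a \<in> A\<close>.\<close>

definition cI :: "nat set \<Rightarrow> nat \<Rightarrow> int \<Rightarrow> nat \<Rightarrow> int" where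
  "cI A m i a = (THE c. \<forall>n. a \<le> n \<and> [int n = i] (mod int m) \<longrightarrow> CI A n a = c)"

definition cII :: "nat set \<Rightarrow> nat \<Rightarrow> int \<Rightarrow> nat \<Rightarrow> int" where
  "cII A m i a = (THE c. \<forall>n. a \<le> n \<and> [int n = i] (mod int m) \<longrightarrow> CII A n a = c)"


section \<open>Solution sets\<close>

definition CS :: "nat \<Rightarrow> (int \<times> int \<times> int) set" where
  "CS m = {(i, b, b'). 0 \<le> i \<and> i < int m \<and> 0 \<le> b \<and> 0 \<le> b'}"

text \<open>The triple \<open>(i', b', b\<^sup>\<dagger>')\<close> reached from \<open>(i, b, b\<^sup>\<dagger>)\<close> by the move \<open>a\<close>; it need not lie in
  \<open>CS m\<close>, since its last two components may be negative.\<close>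

definition step :: "nat set \<Rightarrow> nat \<Rightarrow> nat \<Rightarrow> int \<times> int \<times> int \<Rightarrow> int \<times> int \<times> int" where
  "step A m a = (\<lambda>(i, b, d). ((i - int a) mod int m, d - cII A m i a, b - cI A m i a))"

text \<open>For \<open>A\<close> cash-periodic with period \<open>m\<close>. The least element of \<open>A\<close> is \<open>Min A\<close>.\<close>

definition solution_set :: "nat set \<Rightarrow> nat \<Rightarrow> (int \<times> int \<times> int) set \<Rightarrow> bool" where
  "solution_set A m X \<longleftrightarrow>
    X \<subseteq> CS m \<and>
    (\<forall>t\<in>X. case step A m (Min A) t of (i, b, d) \<Rightarrow>
        (i, b, d) \<in> CS m - X \<or>
        (b \<ge> 0 \<and> d < 0) \<or>
        (b < 0 \<and> d < 0 \<and> W A (nat i) = PlayerII)) \<and>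
    (\<forall>t\<in>CS m - X. \<forall>a\<in>A. case step A m a t of (i, b, d) \<Rightarrow>
        (i, b, d) \<in> X \<or>
        (b < 0 \<and> d \<ge> 0) \<or>
        (b < 0 \<and> d < 0 \<and> W A (nat i) = PlayerI))"

end

theory Submission
  imports Defs
begin

text \<open>
  Everything rests on a closed form. Put
  \<open>cash l n = \<lfloor>(n + 1) / 2\<rfloor> + l * \<lfloor>(n + 2 l) / (4 l)\<rfloor>\<close> for integers \<open>n\<close>. This function is
  monotone, and a shift of its argument by \<open>4 l\<close> adds the constant \<open>3 l\<close>. For \<open>A = {1, 2 l, 2 l + 1}\<close>
  one has \<open>fI A n = cash l n\<close> and \<open>fII A n = cash l (n - 1)\<close> (lemma \<open>fI_fII_eq_cash\<close>): by
  monotonicity, the maximum defining \<open>fII\<close> is attained at the least move \<open>1\<close>, while the minimum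
  defining \<open>fI\<close> is attained at \<open>1\<close>, \<open>2 l\<close> or \<open>2 l + 1\<close> depending on the residue of \<open>n\<close> modulo
  \<open>4 l\<close>. The induction needs the winner of the game without cash: Player II wins exactly at the
  \<open>n\<close> that are even with \<open>n mod 4 l < 2 l\<close>, because these \<open>n\<close> form a kernel of the move relation
  (lemma \<open>W_eq_if_kernel\<close>). Up to the constant \<open>a\<close>, \<open>CI A n a\<close> and \<open>CII A n a\<close> are
  differences of values of \<open>cash\<close>, so the additive shift cancels in them, and cash-periodicity
  follows.

  The condition that defines \<open>X\<close> only compares the blocks \<open>x div l\<close> and \<open>y div l\<close>: it says
  \<open>x div l \<le> y div l\<close> if \<open>i\<close> is odd or \<open>i = 2 l\<close>, and \<open>x div l < y div l\<close> otherwise. The move \<open>1\<close> costs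
  nothing, except that the player to move pays exactly one block at \<open>i = 2 l\<close> and \<open>i = 2 l + 1\<close>. As it
  exchanges the two players, it takes a weak inequality to the failure of a strict one, and
  conversely; at the two exceptional residues a weak inequality is expected on both sides, and the
  extra block makes up for the difference (lemma \<open>unit_move_target\<close>). The moves \<open>2 l\<close> and \<open>2 l + 1\<close>
  cost the opponent so much more than the mover that, from a triple outside \<open>X\<close>, they leave the
  opponent in a strictly smaller block than the mover (lemma \<open>large_move_target\<close>). Now it is the
  opponent's turn, so the strict inequality puts the new triple into \<open>X\<close> at every residue, unless
  the opponent cannot pay.
\<close>

section \<open>Determining the winner from a kernel\<close>

lemma stones_left_snoc: "stones_left n (as @ [a]) = stones_left n as - a"
  by (simp add: stones_left_def)

lemma to_move_snoc: "to_move (as @ [a]) \<noteq> to_move as"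
  by (simp add: to_move_def)

lemma player_neq_trans: "p \<noteq> q \<Longrightarrow> q \<noteq> r \<Longrightarrow> p = (r :: player)"
  by (cases p; cases q; cases r) auto

lemma legal_play_snoc:
  "legal_play A n (as @ [a]) \<longleftrightarrow> legal_play A n as \<and> a \<in> moves A (stones_left n as)"
  by (auto simp: legal_play_def nth_append less_Suc_eq)

lemma follows_snoc:
  "follows \<sigma> p (as @ [a]) \<longleftrightarrow> follows \<sigma> p as \<and> (to_move as = p \<longrightarrow> a = \<sigma> as)"
  by (auto simp: follows_def nth_append less_Suc_eq)

text \<open>Two winning strategies for different players could be played against each other; the
  resulting play ends, since every move removes a stone, and whoever is then unable to move
  contradicts one of the two strategies.\<close>

lemma winning_strategy_unique:
  assumes \<sigma>: "winning_strategy A n p \<sigma>" and \<tau>: "winning_strategy A n q \<tau>"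
  shows "p = q"
proof (rule ccontr)
  assume "p \<noteq> q"
  have False if "legal_play A n as" "follows \<sigma> p as" "follows \<tau> q as" for as
    using that
  proof (induction "stones_left n as" arbitrary: as rule: less_induct)
    case less
    have turn: "to_move as = p \<or> to_move as = q"
      using \<open>p \<noteq> q\<close> by (metis player.exhaust)
    define a where "a = (if to_move as = p then \<sigma> as else \<tau> as)"
    have "moves A (stones_left n as) \<noteq> {}"
      using \<sigma> \<tau> turn less.prems unfolding winning_strategy_def by blast
    then have a: "a \<in> moves A (stones_left n as)"
      using \<sigma> \<tau> turn less.prems unfolding winning_strategy_def a_def by auto
    show False
    proof (rule less.hyps)
      show "stones_left n (as @ [a]) < stones_left n as"
        using a by (auto simp: stones_left_snoc moves_def)
      show "legal_play A n (as @ [a])"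
        using a less.prems by (simp add: legal_play_snoc)
      show "follows \<sigma> p (as @ [a])" "follows \<tau> q (as @ [a])"
        using less.prems \<open>p \<noteq> q\<close> by (auto simp: follows_snoc a_def)
    qed
  qed
  from this[of "[]"] show False
    by (simp add: legal_play_def follows_def)
qed

text \<open>The winner always moves into the kernel \<open>P\<close>. Then the loser always has to move
  from a position in \<open>P\<close>, and only there can a player be stuck.\<close>

lemma W_eq_if_kernel:
  assumes escape: "\<And>n a. n \<in> P \<Longrightarrow> a \<in> moves A n \<Longrightarrow> n - a \<notin> P"
    and enter: "\<And>n. n \<notin> P \<Longrightarrow> \<exists>a\<in>moves A n. n - a \<in> P"
  shows "W A n = (if n \<in> P then PlayerII else PlayerI)"
proof -
  define p where "p = (if n \<in> P then PlayerII else PlayerI)"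
  define \<sigma> where "\<sigma> as = (SOME a. a \<in> moves A (stones_left n as) \<and> stones_left n as - a \<in> P)" for as
  have \<sigma>: "\<sigma> as \<in> moves A (stones_left n as)" "stones_left n as - \<sigma> as \<in> P"
    if "stones_left n as \<notin> P" for as
    using someI_ex[OF enter[OF that, unfolded Bex_def]] unfolding \<sigma>_def by auto
  have inv: "stones_left n as \<in> P \<longleftrightarrow> to_move as \<noteq> p"
    if "legal_play A n as" "follows \<sigma> p as" for as
    using that
  proof (induction as rule: rev_induct)
    case Nil
    show ?case by (simp add: stones_left_def to_move_def p_def)
  next
    case (snoc a as)
    then have IH: "stones_left n as \<in> P \<longleftrightarrow> to_move as \<noteq> p"
      and a: "a \<in> moves A (stones_left n as)" "to_move as = p \<longrightarrow> a = \<sigma> as"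
      by (auto simp: legal_play_snoc follows_snoc)
    show ?case
    proof (cases "to_move as = p")
      case True
      then show ?thesis
        using IH a \<sigma>(2)[of as] to_move_snoc[of as a] by (simp add: stones_left_snoc)
    next
      case False
      then have "to_move (as @ [a]) = p"
        using to_move_snoc[of as a] player_neq_trans by blast
      then show ?thesis
        using IH a False escape by (simp add: stones_left_snoc)
    qed
  qed
  have "winning_strategy A n p \<sigma>"
    unfolding winning_strategy_def
  proof (intro allI impI, elim conjE)
    fix as assume as: "legal_play A n as" "follows \<sigma> p as"
    show "(to_move as = p \<and> moves A (stones_left n as) \<noteq> {} \<longrightarrow> \<sigma> as \<in> moves A (stones_left n as)) \<and>
      (moves A (stones_left n as) = {} \<longrightarrow> to_move as \<noteq> p)"
      using inv[OF as] \<sigma>(1)[of as] by auto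
  qed
  then have "W A n = p"
    unfolding W_def by (intro the_equality) (auto intro: winning_strategy_unique)
  then show ?thesis by (simp add: p_def)
qed

section \<open>The closed form of the cash functions\<close>

definition cash :: "int \<Rightarrow> int \<Rightarrow> int" where
  "cash l n = (n + 1) div 2 + l * ((n + 2 * l) div (4 * l))"

lemma cash_shift:
  assumes "0 < l"
  shows "cash l (n + 4 * l * q) = cash l n + 3 * l * q"
proof -
  have "(n + 4 * l * q + 1) div 2 = (n + 1) div 2 + 2 * l * q"
    using div_mult_self2[of 2 "n + 1" "2 * l * q"] by (simp add: algebra_simps)
  moreover have "(n + 4 * l * q + 2 * l) div (4 * l) = (n + 2 * l) div (4 * l) + q"
    using div_mult_self2[of "4 * l" "n + 2 * l" q] assms by (simp add: algebra_simps)
  ultimately show ?thesis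
    by (simp add: cash_def algebra_simps)
qed

lemma cash_mono: "0 < l \<Longrightarrow> m \<le> n \<Longrightarrow> cash l m \<le> cash l n"
  unfolding cash_def by (intro add_mono mult_left_mono zdiv_mono1) auto

text \<open>A move takes away at most \<open>2 l + 1\<close> stones, and \<open>cash\<close> is evaluated at most one position below
  that; so for residues in \<open>[0, 4 l)\<close> these three blocks of length \<open>4 l\<close> suffice, and they turn
  statements about \<open>cash\<close> into linear arithmetic.\<close>

lemma cash_blocks:
  assumes "- 6 * l \<le> r" "r < 6 * l"
  shows "cash l r = (r + 1) div 2 + (if r < - 2 * l then - l else if r < 2 * l then 0 else l)"
proof -
  have "(r + 2 * l) div (4 * l) = (if r < - 2 * l then - 1 else if r < 2 * l then 0 else 1)"
    using assms
      int_div_pos_eq[of "r + 2 * l" "4 * l" "-1" "r + 6 * l"]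
      int_div_pos_eq[of "r + 2 * l" "4 * l" 0 "r + 2 * l"]
      int_div_pos_eq[of "r + 2 * l" "4 * l" 1 "r - 2 * l"] by auto
  then show ?thesis by (simp add: cash_def)
qed

lemma cash_diff_two_l:
  assumes "0 < l" "- 4 * l \<le> r" "r < 4 * l"
  shows "cash l (r - 2 * l) = (r + 1) div 2 - (if r < 0 then 2 * l else l)"
proof -
  have "(r - 2 * l + 1) div 2 = (r + 1) div 2 - l"
    using div_mult_self2[of 2 "r + 1" "- l"] by (simp add: algebra_simps)
  then show ?thesis
    using assms by (simp add: cash_blocks)
qed

text \<open>These are the closed forms of \<open>CI\<close> and \<open>CII\<close> for the moves \<open>1\<close>, \<open>2 l\<close> and \<open>2 l + 1\<close>. Since \<open>cash\<close> is
  defined on all integers, they also make sense for \<open>n < a\<close>, where \<open>CI\<close> and \<open>CII\<close> do not, so that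
  every cost can be read off at a residue in \<open>[0, 4 l)\<close>.\<close>

definition costI :: "int \<Rightarrow> int \<Rightarrow> int \<Rightarrow> int" where
  "costI l n a = cash l n - cash l (n - a - 1) - a"

definition costII :: "int \<Rightarrow> int \<Rightarrow> int \<Rightarrow> int" where
  "costII l n a = cash l (n - 1) - cash l (n - a)"

lemma cost_mod:
  assumes "0 < l"
  shows "costI l (n mod (4 * l)) a = costI l n a" "costII l (n mod (4 * l)) a = costII l n a"
proof -
  define r q where "r = n mod (4 * l)" and "q = n div (4 * l)"
  have n: "n = r + 4 * l * q"
    by (simp add: r_def q_def)
  have shift: "cash l (n - c) = cash l (r - c) + 3 * l * q" for c
    using cash_shift[OF assms, of "r - c" q] by (simp add: n algebra_simps)
  show "costI l (n mod (4 * l)) a = costI l n a" "costII l (n mod (4 * l)) a = costII l n a"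
    unfolding r_def[symmetric] costI_def costII_def
    using shift[of 0] shift[of 1] shift[of a] shift[of "a + 1"] by (simp_all add: algebra_simps)
qed

lemma cost_one:
  assumes "0 < l" "0 \<le> i" "i < 4 * l"
  shows "costI l i 1 = (if i = 2 * l \<or> i = 2 * l + 1 then l else 0)" "costII l i 1 = 0"
  using assms by (auto simp: costI_def costII_def cash_blocks)

lemma cost_two_l:
  assumes "0 < l" "0 \<le> i" "i < 4 * l"
  shows "costI l i (2 * l) = (if i < 2 * l \<and> i \<noteq> 0 then - l else 0) + i mod 2"
    and "costII l i (2 * l) = (if i \<le> 2 * l then l else 2 * l) - i mod 2"
proof -
  have "cash l (i - 2 * l - 1) = cash l (i - 1 - 2 * l)"
    by (simp add: algebra_simps)
  moreover have "(i + 1) div 2 = i div 2 + i mod 2"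
    by presburger
  ultimately show "costI l i (2 * l) = (if i < 2 * l \<and> i \<noteq> 0 then - l else 0) + i mod 2"
    and "costII l i (2 * l) = (if i \<le> 2 * l then l else 2 * l) - i mod 2"
    using assms cash_blocks[of l i] cash_blocks[of l "i - 1"]
      cash_diff_two_l[of l i] cash_diff_two_l[of l "i - 1"]
    unfolding costI_def costII_def by (auto split: if_splits)
qed

lemma cost_two_l_plus_one:
  assumes "0 < l" "0 \<le> i" "i < 4 * l"
  shows "costI l i (2 * l + 1) = (if 2 \<le> i \<and> i < 2 * l then - l else 0)"
    and "costII l i (2 * l + 1) = (if 1 \<le> i \<and> i \<le> 2 * l then l else 2 * l)"
proof -
  have "cash l (i - (2 * l + 1) - 1) = cash l (i - 2 - 2 * l)"
    "cash l (i - (2 * l + 1)) = cash l (i - 1 - 2 * l)"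
    by (simp_all add: algebra_simps)
  moreover have "(i - 1) div 2 = (i + 1) div 2 - 1"
    by presburger
  ultimately show "costI l i (2 * l + 1) = (if 2 \<le> i \<and> i < 2 * l then - l else 0)"
    and "costII l i (2 * l + 1) = (if 1 \<le> i \<and> i \<le> 2 * l then l else 2 * l)"
    unfolding costI_def costII_def
    using assms cash_blocks[of l i] cash_blocks[of l "i - 1"]
      cash_diff_two_l[of l "i - 1"] cash_diff_two_l[of l "i - 2"]
    by (auto split: if_splits)
qed

section \<open>The game with moves \<open>1\<close>, \<open>2 l\<close> and \<open>2 l + 1\<close>\<close>

definition kernel :: "nat \<Rightarrow> nat set" where
  "kernel l = {n. even n \<and> n mod (4 * l) < 2 * l}"

lemma even_mod_four_mult: "even (n mod (4 * l)) \<longleftrightarrow> even (n :: nat)"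
  by (metis dvd_mod_iff dvd_mult2 even_numeral)

lemma mod_diff_move:
  fixes n a k :: nat
  assumes "a \<le> n" "a \<le> k"
  shows "(n - a) mod k = (if a \<le> n mod k then n mod k - a else n mod k + k - a)"
proof (cases "a \<le> n mod k")
  case True
  have "n - a = n div k * k + (n mod k - a)"
    using True by (metis Nat.add_diff_assoc div_mult_mod_eq)
  moreover have "n mod k - a < k \<or> k = 0"
    by (metis less_imp_diff_less mod_less_divisor neq0_conv)
  ultimately show ?thesis
    using True by (metis mod_less mod_mult_self3 mod_by_0 mult_0_right plus_nat.add_0)
next
  case False
  then have "n div k \<noteq> 0"
    using assms by (metis div_mult_mod_eq mult_0 plus_nat.add_0)
  then obtain q where q: "n div k = Suc q"
    using not0_implies_Suc by blast
  have "n = Suc q * k + n mod k"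
    using q by (metis div_mult_mod_eq)
  then have "n - a = q * k + (n mod k + k - a)"
    using assms by auto
  moreover have "n mod k + k - a < k"
    using False assms by auto
  ultimately show ?thesis
    using False by (metis mod_less mod_mult_self3)
qed

text \<open>A move of cost \<open>0\<close> contributes exactly \<open>cash l n\<close> to the minimum that defines \<open>fI\<close>.\<close>

lemma costI_best_move:
  assumes l: "0 < l" and i: "0 \<le> i" "i < 4 * l"
  shows "i < 2 * l \<Longrightarrow> costI l i 1 = 0"
    and "2 * l \<le> i \<Longrightarrow> even i \<Longrightarrow> costI l i (2 * l) = 0"
    and "2 * l \<le> i \<Longrightarrow> costI l i (2 * l + 1) = 0"
  using i cost_one(1)[OF l i] cost_two_l(1)[OF l i] cost_two_l_plus_one(1)[OF l i]
  by (auto simp: even_iff_mod_2_eq_zero)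

lemma kernel_int:
  "n \<in> kernel l \<longleftrightarrow> even n \<and> int n mod (4 * int l) < 2 * int l"
proof -
  have "int n mod (4 * int l) = int (n mod (4 * l))"
    by (simp add: zmod_int)
  then show ?thesis
    by (auto simp: kernel_def)
qed

text \<open>The move is \<open>1\<close> from an odd residue below \<open>2 l\<close>; from the upper half of the residues,
  subtracting \<open>2 l\<close> or \<open>2 l + 1\<close>, whichever has the parity of the residue, gives an even residue
  below \<open>2 l\<close>. It wins and is also optimal for the cash, so it serves both for the winner and for the
  minimum in \<open>fI\<close>.\<close>

lemma move_into_kernel:
  fixes l n :: nat
  assumes l: "0 < l" and n: "n \<notin> kernel l"
  obtains a where "a \<in> moves {1, 2 * l, 2 * l + 1} n" "n - a \<in> kernel l"
    "costI (int l) (int n) (int a) = 0"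
proof -
  define r where "r = n mod (4 * l)"
  define a where "a = (if r < 2 * l then 1 else if even r then 2 * l else 2 * l + 1)"
  have parity: "even n \<longleftrightarrow> even r"
    by (simp add: r_def even_mod_four_mult)
  have r: "r < 4 * l" "r \<le> n"
    using l by (simp_all add: r_def)
  have odd: "r < 2 * l \<Longrightarrow> odd r"
    using n parity by (auto simp: kernel_def r_def)
  have ar: "a \<le> r"
    unfolding a_def using odd by (cases "r = 2 * l"; cases "r = 0") auto
  have a: "a \<le> n" "a \<le> 4 * l"
    using ar r by auto
  have "(n - a) mod (4 * l) = r - a"
    using mod_diff_move[OF a] ar by (simp add: r_def)
  moreover have "even (n - a)"
    using a ar odd parity by (auto simp: a_def)
  moreover have "r - a < 2 * l"
    using r l by (auto simp: a_def)
  ultimately have "n - a \<in> kernel l"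
    by (simp add: kernel_def)
  moreover have "a \<in> moves {1, 2 * l, 2 * l + 1} n"
    using a l by (auto simp: moves_def a_def)
  moreover have "costI (int l) (int n) (int a) = 0"
  proof -
    have "costI (int l) (int n) (int a) = costI (int l) (int r) (int a)"
      using cost_mod(1)[of "int l" "int n" "int a"] l by (simp add: r_def zmod_int)
    also have "\<dots> = 0"
      using costI_best_move[of "int l" "int r"] l r by (auto simp: a_def ac_simps)
    finally show ?thesis .
  qed
  ultimately show ?thesis
    using that by blast
qed

lemma W_eq:
  assumes "0 < l"
  shows "W {1, 2 * l, 2 * l + 1} n = (if n \<in> kernel l then PlayerII else PlayerI)"
proof (rule W_eq_if_kernel)
  fix n a assume n: "n \<in> kernel l" and a: "a \<in> moves {1, 2 * l, 2 * l + 1} n"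
  have "a \<le> n" "a \<le> 4 * l" "a = 1 \<or> a = 2 * l \<or> a = 2 * l + 1"
    using a assms by (auto simp: moves_def)
  then show "n - a \<notin> kernel l"
    using n assms even_mod_four_mult[of n l]
    by (auto simp: kernel_def mod_diff_move[of a n "4 * l"])
next
  fix n assume "n \<notin> kernel l"
  then show "\<exists>a\<in>moves {1, 2 * l, 2 * l + 1} n. n - a \<in> kernel l"
    using move_into_kernel[OF assms] by metis
qed

text \<open>Only \<open>a = 1\<close> and \<open>a = 2 l\<close> can have positive cost for Player I, the former from the residues
  \<open>2 l\<close> and \<open>2 l + 1\<close>, the latter from odd residues, and such a move neither starts nor ends in the
  kernel. If \<open>n\<close> is in the kernel, this covers all moves; otherwise the minimum that
  defines \<open>fI\<close> ranges over the moves into the kernel.\<close>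

lemma costI_nonpos:
  fixes l n a :: nat
  assumes l: "0 < l" and a: "a \<in> moves {1, 2 * l, 2 * l + 1} n"
    and kernel: "n \<in> kernel l \<or> n - a \<in> kernel l"
  shows "costI (int l) (int n) (int a) \<le> 0"
proof -
  define r where "r = n mod (4 * l)"
  have r: "int r = int n mod (4 * int l)"
    by (simp add: r_def zmod_int)
  have "r < 4 * l"
    using l by (simp add: r_def)
  then have bounds: "0 \<le> int r" "int r < 4 * int l"
    by linarith+
  have parity: "even n \<longleftrightarrow> even r"
    by (simp add: r_def even_mod_four_mult)
  have cost: "costI (int l) (int n) (int a) = costI (int l) (int r) (int a)"
    using cost_mod(1)[of "int l" "int n" "int a"] l by (simp add: r)
  have "a \<le> n" "a \<le> 4 * l" "a = 1 \<or> a = 2 * l \<or> a = 2 * l + 1"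
    using a l by (auto simp: moves_def)
  then consider "a = 1" | "a = 2 * l" | "a = 2 * l + 1"
    by blast
  then show ?thesis
  proof cases
    case 1
    have "r \<noteq> 2 * l \<and> r \<noteq> 2 * l + 1"
      using kernel mod_diff_move[OF \<open>a \<le> n\<close> \<open>a \<le> 4 * l\<close>] parity l \<open>a \<le> n\<close>
      by (auto simp: kernel_def r_def[symmetric] 1)
    then show ?thesis
      unfolding cost using cost_one(1)[OF _ bounds] l by (auto simp: 1)
  next
    case 2
    then have "even r"
      using kernel parity \<open>a \<le> n\<close> by (auto simp: kernel_def)
    then have "int r mod 2 = 0"
      by presburger
    then show ?thesis
      unfolding cost using cost_two_l(1)[OF _ bounds] l by (auto simp: 2)
  next
    case 3
    then show ?thesis
      unfolding cost using cost_two_l_plus_one(1)[OF _ bounds] l by (auto simp: algebra_simps)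
  qed
qed

lemma costI_one_kernel:
  assumes "0 < l" "n \<in> kernel l"
  shows "costI (int l) (int n) 1 = 0"
proof -
  have "int n mod (4 * int l) < 2 * int l"
    using assms(2) by (simp add: kernel_int)
  then show ?thesis
    using costI_best_move(1)[of "int l" "int n mod (4 * int l)"] cost_mod(1)[of "int l" "int n" 1] assms(1)
    by simp
qed

lemma fI_fII_eq_cash:
  assumes l: "0 < l" and A: "A = {1, 2 * l, 2 * l + 1}"
  shows "int (fI A n) = cash (int l) (int n) \<and> int (fII A n) = cash (int l) (int n - 1)"
proof (induction n rule: less_induct)
  case (less n)
  show ?case
  proof (cases "n = 0")
    case True
    then show ?thesis
      using l by (simp add: fI.simps[of A 0] fII.simps[of A 0] cash_blocks)
  next
    case False
    have fin: "finite (moves A n)"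
      by (simp add: A moves_def)
    have one: "1 \<in> moves A n"
      using False by (simp add: A moves_def)
    have IHI: "int (fI A (n - a)) = cash (int l) (int n - int a)"
      and IHII: "int (fII A (n - a) + a) = cash (int l) (int n) - costI (int l) (int n) (int a)" if "a \<in> moves A n" for a
      using that less.IH[of "n - a"] by (auto simp: moves_def of_nat_diff costI_def)

    have "Max ((\<lambda>a. fI A (n - a)) ` moves A n) = fI A (n - 1)"
    proof (rule Max_eqI)
      show "y \<le> fI A (n - 1)" if y: "y \<in> (\<lambda>a. fI A (n - a)) ` moves A n" for y
      proof -
        obtain a where a: "a \<in> moves A n" "y = fI A (n - a)"
          using y by blast
        have "1 \<le> a" using a by (auto simp: moves_def)
        then have "cash (int l) (int n - int a) \<le> cash (int l) (int n - int 1)"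
          using l by (intro cash_mono) auto
        then show ?thesis
          using IHI[OF a(1)] IHI[OF one] a(2) by linarith
      qed
    qed (use fin one in auto)
    then have fII: "int (fII A n) = cash (int l) (int n - 1)"
      using IHI[OF one] False by (simp add: fII.simps[of A n])

    have W: "W A k = (if k \<in> kernel l then PlayerII else PlayerI)" for k
      unfolding A by (rule W_eq[OF l])

    have minimum: "int (Min ((\<lambda>a. fII A (n - a) + a) ` S)) = cash (int l) (int n)"
      if S: "S \<subseteq> moves A n" "a \<in> S" "costI (int l) (int n) (int a) = 0" "\<And>b. b \<in> S \<Longrightarrow> costI (int l) (int n) (int b) \<le> 0" for S a
    proof -
      have "Min ((\<lambda>a. fII A (n - a) + a) ` S) = fII A (n - a) + a"
      proof (rule Min_eqI)
        show "fII A (n - a) + a \<le> y" if y: "y \<in> (\<lambda>a. fII A (n - a) + a) ` S" for y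
        proof -
          obtain b where b: "b \<in> S" "y = fII A (n - b) + b"
            using y by blast
          have "a \<in> moves A n" "b \<in> moves A n"
            using S b by auto
          then show ?thesis
            using IHII[of a] IHII[of b] S(3) S(4)[OF b(1)] b(2) by linarith
        qed
      qed (use finite_subset[OF S(1) fin] S(2) in auto)
      then show ?thesis
        using IHII[of a] S by auto
    qed
    have "int (fI A n) = cash (int l) (int n)"
    proof (cases "n \<in> kernel l")
      case True
      then have "int (Min ((\<lambda>a. fII A (n - a) + a) ` {a \<in> moves A n. fI A (n - a) = fII A n})) = cash (int l) (int n)"
      proof (intro minimum)
        show "1 \<in> {a \<in> moves A n. fI A (n - a) = fII A n}"
          using one IHI[OF one] fII by auto
        show "costI (int l) (int n) (int 1) = 0"
          using costI_one_kernel[OF l True] by simp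
        show "costI (int l) (int n) (int b) \<le> 0" if "b \<in> {a \<in> moves A n. fI A (n - a) = fII A n}" for b
          using that True costI_nonpos[OF l] by (auto simp: A)
      qed auto
      then show ?thesis
        using True False W by (simp add: fI.simps[of A n])
    next
      case outside: False
      then obtain a where a: "a \<in> moves A n" "n - a \<in> kernel l" "costI (int l) (int n) (int a) = 0"
        unfolding A by (rule move_into_kernel[OF l])
      then have "int (Min ((\<lambda>a. fII A (n - a) + a) ` {a \<in> moves A n. W A (n - a) = PlayerII})) = cash (int l) (int n)"
      proof (intro minimum)
        show "a \<in> {a \<in> moves A n. W A (n - a) = PlayerII}"
          using W a by simp
        show "costI (int l) (int n) (int a) = 0"
          by (rule a)
        show "costI (int l) (int n) (int b) \<le> 0" if "b \<in> {a \<in> moves A n. W A (n - a) = PlayerII}" for b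
          using that W costI_nonpos[OF l, of b n] by (auto simp: A split: if_splits)
      qed auto
      then show ?thesis
        using outside False W by (simp add: fI.simps[of A n])
    qed
    then show ?thesis
      using fII by blast
  qed
qed

lemma CI_CII_eq_cost:
  assumes "0 < l" "A = {1, 2 * l, 2 * l + 1}" "a \<le> n"
  shows "CI A n a = costI (int l) (int n) (int a)" "CII A n a = costII (int l) (int n) (int a)"
  using fI_fII_eq_cash[OF assms(1,2), of n] fI_fII_eq_cash[OF assms(1,2), of "n - a"] assms(3)
  by (simp_all add: CI_def CII_def costI_def costII_def of_nat_diff)

lemma cost_cong:
  assumes "0 < l" "[n = i] (mod 4 * l)"
  shows "costI l n a = costI l i a" "costII l n a = costII l i a"
  using assms cost_mod[of l n a] cost_mod[of l i a] by (simp_all add: cong_def)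

lemma cash_periodic_two_l:
  assumes l: "0 < l" and A: "A = {1, 2 * l, 2 * l + 1}"
  shows "cash_periodic A (4 * l)"
  unfolding cash_periodic_def
proof (intro conjI allI impI ballI)
  show "0 < 4 * l"
    using l by simp
next
  fix n1 n2 assume n: "[n1 = n2] (mod 4 * l)"
  then have "n1 \<in> kernel l \<longleftrightarrow> n2 \<in> kernel l"
    using even_mod_four_mult[of n1 l] even_mod_four_mult[of n2 l] by (simp add: kernel_def cong_def)
  then show "W A n1 = W A n2"
    using W_eq[OF l] A by simp
  have n': "[int n1 = int n2] (mod 4 * int l)"
    using n by (simp flip: cong_int_iff)
  fix a assume "a \<le> n1 \<and> a \<le> n2"
  then show "CI A n1 a = CI A n2 a" "CII A n1 a = CII A n2 a"
    using CI_CII_eq_cost[OF l A] cost_cong[OF _ n'] l by auto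
qed

lemma cI_cII_eq_cost:
  assumes l: "0 < l" and A: "A = {1, 2 * l, 2 * l + 1}" and "a \<in> A" and i: "0 \<le> i"
  shows "cI A (4 * l) i a = costI (int l) i (int a)" "cII A (4 * l) i a = costII (int l) i (int a)"
proof -
  \<comment> \<open>adding a full period makes the move \<open>a\<close> legal\<close>
  define n where "n = nat i + 4 * l"
  have n: "a \<le> n" "[int n = i] (mod int (4 * l))"
    using assms by (auto simp: n_def cong_def)
  have eq: "CI A k a = costI (int l) i (int a)" "CII A k a = costII (int l) i (int a)"
    if "a \<le> k \<and> [int k = i] (mod int (4 * l))" for k
    using that CI_CII_eq_cost[OF l A, of a k] cost_cong[of "int l" "int k" i "int a"] l by auto
  show "cI A (4 * l) i a = costI (int l) i (int a)"
    unfolding cI_def using n eq by (intro the_equality) auto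
  show "cII A (4 * l) i a = costII (int l) i (int a)"
    unfolding cII_def using n eq by (intro the_equality) auto
qed

section \<open>The solution set in terms of blocks\<close>

definition block_set :: "nat \<Rightarrow> (int \<times> int \<times> int) set" where
  "block_set l = {(i, x, y) \<in> CS (4 * l).
     if odd i \<or> i = 2 * int l then x div int l \<le> y div int l else x div int l < y div int l}"

lemma block_set_eq:
  assumes "0 < l"
  shows "block_set l = {(i, x, y) \<in> CS (4 * l).
    ((odd i \<or> i = 2 * int l) \<longrightarrow> y \<ge> (x div int l) * int l) \<and>
    ((even i \<and> i \<noteq> 2 * int l) \<longrightarrow> x < (y div int l) * int l)}"
proof -
  have less: "x div int l < k \<longleftrightarrow> x < k * int l" for x k :: int
  proof
    assume "x div int l < k"
    then have "(x div int l + 1) * int l \<le> k * int l"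
      by (intro mult_right_mono) auto
    then show "x < k * int l"
      unfolding distrib_right
      using assms pos_mod_bound[of "int l" x] div_mult_mod_eq[of x "int l"] by linarith
  next
    assume "x < k * int l"
    then have "x div int l * int l < k * int l"
      using assms pos_mod_sign[of "int l" x] div_mult_mod_eq[of x "int l"] by linarith
    then show "x div int l < k"
      using assms by simp
  qed
  then have "x div int l < y div int l \<longleftrightarrow> x < (y div int l) * int l"
    and "x div int l \<le> y div int l \<longleftrightarrow> (x div int l) * int l \<le> y" for x y :: int
    using less[of y "x div int l"] by (auto simp flip: linorder_not_less)
  then show ?thesis
    by (auto simp: block_set_def)
qed

lemma strict_block_mem:
  assumes "0 \<le> i" "i < 4 * int l" "0 \<le> x" "0 \<le> y" "x div int l < y div int l"
  shows "(i, x, y) \<in> block_set l"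
  using assms by (auto simp: block_set_def CS_def)

lemma not_mem_block_set:
  assumes "(i, x, y) \<in> CS (4 * l) - block_set l"
  shows "if odd i \<or> i = 2 * int l then y div int l < x div int l else y div int l \<le> x div int l"
  using assms by (auto simp: block_set_def)

lemma div_block_less_mono:
  fixes l :: int
  assumes "0 < l" "b \<le> y - k * l" "x - k * l \<le> d" "y div l < x div l"
  shows "b div l < d div l"
proof -
  have "b div l \<le> (y - k * l) div l"
    using assms by (simp add: zdiv_mono1)
  also have "\<dots> = y div l - k"
    using assms(1) div_mult_self1[of l y "- k"] by simp
  also have "\<dots> < x div l - k"
    using assms by simp
  also have "\<dots> = (x - k * l) div l"
    using assms(1) div_mult_self1[of l x "- k"] by simp
  also have "\<dots> \<le> d div l"
    using assms by (simp add: zdiv_mono1)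
  finally show ?thesis .
qed

text \<open>This is the effect of the move \<open>1\<close> at the two residues where it costs a block: paying it
  makes up for the difference between a weak and a strict inequality.\<close>

lemma div_pay_block:
  fixes l :: int
  assumes "0 < l"
  shows "y div l \<le> (x - l) div l \<longleftrightarrow> y div l < x div l"
  using assms div_mult_self1[of l x "-1"] by auto

text \<open>Each alternative makes the opponent's block strictly smaller than the mover's, starting from
  a triple outside \<open>block_set\<close>. If the opponent pays at least a block and the mover nothing, a weak
  inequality beforehand is enough. At odd residues the inequality is strict beforehand, so there the
  opponent may pay as little as nothing if the mover does not pay, and the mover may
  pay up to a block if the opponent does.\<close>

lemma cost_large_move:
  assumes l: "0 < l" and i: "0 \<le> i" "i < 4 * l" and a: "a = 2 * l \<or> a = 2 * l + 1"
  shows "l \<le> costII l i a \<and> costI l i a \<le> 0 \<or>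
    odd i \<and> 0 \<le> costII l i a \<and> costI l i a \<le> 0 \<or>
    odd i \<and> l \<le> costII l i a \<and> costI l i a \<le> l"
proof (cases "a = 2 * l")
  case True
  show ?thesis
    using l i by (cases "even i") (auto simp: True cost_two_l(1) cost_two_l(2) mod2_eq_if)
next
  case False
  then have "a = 2 * l + 1"
    using a by blast
  then show ?thesis
    using l i by (auto simp: cost_two_l_plus_one(1) cost_two_l_plus_one(2))
qed

lemma block_le_if_div_less:
  fixes l x y :: int
  assumes "0 < l" "0 \<le> x" "0 \<le> y" "y div l < x div l"
  shows "l \<le> x"
proof (rule ccontr)
  assume "\<not> l \<le> x"
  then have "x div l = 0"
    using assms by simp
  moreover have "0 \<le> y div l"
    using assms by (simp add: pos_imp_zdiv_nonneg_iff)
  ultimately show False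
    using assms by simp
qed

lemma large_move_target:
  fixes l i x y a :: int
  assumes l: "0 < l" and i: "0 \<le> i" "i < 4 * l" and a: "a = 2 * l \<or> a = 2 * l + 1"
    and xy: "0 \<le> x" "0 \<le> y" and weak: "y div l \<le> x div l" and strict: "odd i \<Longrightarrow> y div l < x div l"
  shows "0 \<le> x - costI l i a" "(y - costII l i a) div l < (x - costI l i a) div l"
proof -
  have x_ge: "l \<le> x" if "odd i"
    using block_le_if_div_less strict[OF that] l xy by blast
  have "(y - l) div l < x div l"
    using weak l div_mult_self1[of l y "-1"] by simp
  then show "0 \<le> x - costI l i a" "(y - costII l i a) div l < (x - costI l i a) div l"
    using cost_large_move[OF l i a] x_ge xy strict l
      div_block_less_mono[of l "y - costII l i a" "y - l" 0 x "x - costI l i a"]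
      div_block_less_mono[of l "y - costII l i a" y 0 x "x - costI l i a"]
      div_block_less_mono[of l "y - costII l i a" y 1 x "x - costI l i a"]
    by auto
qed

lemma pred_mod_parity:
  fixes i k :: int
  assumes "0 \<le> i" "i < 4 * k"
  shows "0 \<le> (i - 1) mod (4 * k)" "(i - 1) mod (4 * k) < 4 * k"
    and "odd ((i - 1) mod (4 * k)) \<longleftrightarrow> even i"
    and "(i - 1) mod (4 * k) = 2 * k \<longleftrightarrow> i = 2 * k + 1"
proof -
  have *: "(i - 1) mod (4 * k) = (if i = 0 then 4 * k - 1 else i - 1)"
    using assms by (auto simp: zmod_minus1)
  show "0 \<le> (i - 1) mod (4 * k)" "(i - 1) mod (4 * k) < 4 * k"
    using assms by auto
  show "odd ((i - 1) mod (4 * k)) \<longleftrightarrow> even i" "(i - 1) mod (4 * k) = 2 * k \<longleftrightarrow> i = 2 * k + 1"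
    unfolding * using assms by auto presburger+
qed

text \<open>The move \<open>1\<close> swaps the two amounts and changes the parity of the residue. Away from \<open>2 l\<close> and
  \<open>2 l + 1\<close> this turns the condition into its negation, because weak and strict inequalities
  alternate with the parity; from \<open>2 l\<close> and \<open>2 l + 1\<close> the inequality is weak before and after the
  move, and the block that the mover pays restores the negation.\<close>

lemma unit_move_target:
  fixes i x y :: int
  assumes l: "0 < l" and t: "(i, x, y) \<in> CS (4 * l)" and pos: "0 \<le> x - costI (int l) i 1"
  shows "((i - 1) mod (4 * int l), y, x - costI (int l) i 1) \<in> block_set l \<longleftrightarrow> (i, x, y) \<notin> block_set l"
proof -
  have i: "0 \<le> i" "i < 4 * int l" and xy: "0 \<le> x" "0 \<le> y"
    using t by (auto simp: CS_def)
  let ?j = "(i - 1) mod (4 * int l)" and ?d = "x - costI (int l) i 1"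
  note j = pred_mod_parity[OF i]
  have source: "(i, x, y) \<in> block_set l \<longleftrightarrow>
      (if odd i \<or> i = 2 * int l then x div int l \<le> y div int l else x div int l < y div int l)"
    using t by (simp add: block_set_def)
  have target: "(?j, y, ?d) \<in> block_set l \<longleftrightarrow>
      (if even i \<or> i = 2 * int l + 1 then y div int l \<le> ?d div int l else y div int l < ?d div int l)"
    using j(1,2) pos xy unfolding j(3,4)[symmetric] by (simp add: block_set_def CS_def)
  have cost: "costI (int l) i 1 = (if i = 2 * int l \<or> i = 2 * int l + 1 then int l else 0)"
    using cost_one(1)[OF _ i] l by simp
  have pay: "y div int l \<le> (x - int l) div int l \<longleftrightarrow> y div int l < x div int l"
    using div_pay_block l by simp
  have "even (2 * int l)" "odd (2 * int l + 1)"
    by simp_all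
  then consider "i = 2 * int l" | "i = 2 * int l + 1" | "even i" "i \<noteq> 2 * int l" "i \<noteq> 2 * int l + 1"
    | "odd i" "i \<noteq> 2 * int l" "i \<noteq> 2 * int l + 1"
    by blast
  then show ?thesis
    unfolding source target unfolding cost by cases (simp_all add: pay not_le not_less)
qed

lemma solution_set_block_set:
  assumes l: "0 < l" and A: "A = {1, 2 * l, 2 * l + 1}"
  shows "solution_set A (4 * l) (block_set l)"
proof -
  have Min_A: "Min A = 1"
    using l by (intro Min_eqI) (auto simp: A)
  have step: "step A (4 * l) a (i, x, y) =
      ((i - int a) mod (4 * int l), y - costII (int l) i (int a), x - costI (int l) i (int a))"
    if "a \<in> A" "(i, x, y) \<in> CS (4 * l)" for a i x y
    using that cI_cII_eq_cost[OF l A that(1)] by (auto simp: step_def CS_def)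
  show ?thesis
    unfolding solution_set_def Min_A
  proof (intro conjI ballI)
    show "block_set l \<subseteq> CS (4 * l)"
      by (auto simp: block_set_def)
  next
    fix t assume "t \<in> block_set l"
    then obtain i x y where t: "t = (i, x, y)" "(i, x, y) \<in> block_set l" "(i, x, y) \<in> CS (4 * l)"
      by (auto simp: block_set_def)
    then have i: "0 \<le> i" "i < 4 * int l" and y: "0 \<le> y"
      by (auto simp: CS_def)
    show "case step A (4 * l) 1 t of (i, b, d) \<Rightarrow>
        (i, b, d) \<in> CS (4 * l) - block_set l \<or> (b \<ge> 0 \<and> d < 0) \<or>
        (b < 0 \<and> d < 0 \<and> W A (nat i) = PlayerII)"
      using unit_move_target[OF l t(3)] t(2) y pred_mod_parity(1,2)[OF i]
        cost_one(2)[OF _ i] step[of 1, OF _ t(3)] l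
      by (auto simp: t(1) A CS_def)
  next
    fix t a assume "t \<in> CS (4 * l) - block_set l" and a: "a \<in> A"
    then obtain i x y where t: "t = (i, x, y)" "(i, x, y) \<in> CS (4 * l) - block_set l"
      by (cases t) auto
    then have i: "0 \<le> i" "i < 4 * int l" and xy: "0 \<le> x" "0 \<le> y"
      by (auto simp: CS_def)
    have blocks: "y div int l \<le> x div int l" "odd i \<or> i = 2 * int l \<Longrightarrow> y div int l < x div int l"
      using not_mem_block_set[OF t(2)] by (auto split: if_splits)
    let ?d = "x - costI (int l) i (int a)" and ?b = "y - costII (int l) i (int a)"
    have "0 \<le> ?d \<and> (0 \<le> ?b \<longrightarrow> ((i - int a) mod (4 * int l), ?b, ?d) \<in> block_set l)"
    proof (cases "a = 1")
      case True
      have "int l \<le> x" if "y div int l < x div int l"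
        using block_le_if_div_less[OF _ xy that] l by simp
      then have "0 \<le> x - costI (int l) i 1"
        using cost_one(1)[OF _ i] blocks(2) xy l by auto
      then show ?thesis
        using unit_move_target[OF l, of i x y] t(2) cost_one(2)[OF _ i] l True by auto
    next
      case False
      then have "int a = 2 * int l \<or> int a = 2 * int l + 1"
        using a A by auto
      then show ?thesis
        using large_move_target[OF _ i, of "int a" x y] blocks xy l
        by (auto intro!: strict_block_mem)
    qed
    then show "case step A (4 * l) a t of (i, b, d) \<Rightarrow>
        (i, b, d) \<in> block_set l \<or> (b < 0 \<and> d \<ge> 0) \<or>
        (b < 0 \<and> d < 0 \<and> W A (nat i) = PlayerI)"
      using step[OF a, of i x y] t by auto
  qed
qed

theorem lemma7p5:
  fixes L l :: nat and A :: "nat set" and X :: "(int \<times> int \<times> int) set"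
  assumes "L = 2 * l" and "L \<ge> 2"
    and "A = {1, L, L + 1}"
    and "X = {(i, x, y) \<in> CS (2 * L).
               ((odd i \<or> i = int L) \<longrightarrow> y \<ge> (x div int l) * int l) \<and>
               ((even i \<and> i \<noteq> int L) \<longrightarrow> x < (y div int l) * int l)}"
  shows "cash_periodic A (2 * L) \<and> solution_set A (2 * L) X"
proof -
  have l: "0 < l" and A: "A = {1, 2 * l, 2 * l + 1}" and m: "2 * L = 4 * l"
    using assms by auto
  have "X = block_set l"
    using block_set_eq[OF l] by (simp add: assms(1,4))
  then show ?thesis
    using cash_periodic_two_l[OF l A] solution_set_block_set[OF l A] m by simp
qed

end
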